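(* For each $n$, let $A_{n,t}=(a_{ij})_{1\le i,j\le n}$ be a random complex matrix such that $\{(a_{ij},a_{ji}):1\le i<j\le n\}$ are i.i.d. centered pairs which are independent of the i.i.d. centered family $\{a_{ii}:1\le i\le n\}$, with $\mathbb E[|a_{ij}|^2]<\infty$ for all $1\le i,j\le n$ and $\mathbb E[a_{12}a_{21}]=t\in[0,1]$. Then, for $z$ uniformly in $\mathbb D$, $$\lim_{n\to+\infty}\mathbb E\left[\det\left(1+tz^2-\frac{z}{\sqrt n}A_{n,t}\right)e^{-\frac{ntz^2}{2}}\right]=\frac{1}{\sqrt{1-tz^2}}.$$
   Context: $\mathbb D=\{z\in\mathbb C:|z|<1\}$. Scalars inside a determinant stand for scalar multiples of the $n\times n$ identity matrix. The square root is the holomorphic branch on $\mathbb D$ of $\sqrt{1-tz^2}$ equal to $1$ at $z=0$.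
   Formalization: Uniform convergence on all of D is stated for t<1; for t=1 it is stated uniformly on compact subsets of D, since the literal claim fails there: each expectation is bounded on D while 1/sqrt(1-z^2) is not. *)

theory Defs
  imports "HOL-Probability.Probability" "HOL-Complex_Analysis.Complex_Analysis"
    "Jordan_Normal_Form.Determinant"
begin

(* JNF matrices are indexed from 0: the entry a_{ij} (1 \<le> i, j \<le> n) is  A \<omega> $$ (i - 1, j - 1). *)

definition pair_indices :: "nat \<Rightarrow> (nat \<times> nat) set" where
  "pair_indices n = {(i, j). i < j \<and> j < n}"

definition entry_pair :: "('w \<Rightarrow> complex mat) \<Rightarrow> nat \<times> nat \<Rightarrow> 'w \<Rightarrow> complex \<times> complex" where
  "entry_pair A p \<omega> = (A \<omega> $$ (fst p, snd p), A \<omega> $$ (snd p, fst p))"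

definition diag_entry :: "('w \<Rightarrow> complex mat) \<Rightarrow> nat \<Rightarrow> 'w \<Rightarrow> complex" where
  "diag_entry A i \<omega> = A \<omega> $$ (i, i)"

definition (in prob_space) iid_vars :: "'b measure \<Rightarrow> ('i \<Rightarrow> 'a \<Rightarrow> 'b) \<Rightarrow> 'i set \<Rightarrow> bool" where
  "iid_vars N X I \<longleftrightarrow> indep_vars (\<lambda>_. N) X I \<and> (\<forall>i\<in>I. \<forall>j\<in>I. distr M N (X i) = distr M N (X j))"

(* The library's indep_var relates variables with values in one type only, and the two families
   below have different index and value types; so the independence of the families X and Y is
   stated as the independence of the sigma-algebras that they generate. *)
definition (in prob_space) indep_families ::
  "'b measure \<Rightarrow> ('i \<Rightarrow> 'a \<Rightarrow> 'b) \<Rightarrow> 'i set \<Rightarrow> 'c measure \<Rightarrow> ('j \<Rightarrow> 'a \<Rightarrow> 'c) \<Rightarrow> 'j set \<Rightarrow> bool" where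
  "indep_families N X I L Y J \<longleftrightarrow>
     indep_set
       (sigma_sets (space M) {X i -` B \<inter> space M | i B. i \<in> I \<and> B \<in> sets N})
       (sigma_sets (space M) {Y j -` C \<inter> space M | j C. j \<in> J \<and> C \<in> sets L})"

(* The moment condition makes all entries integrable, and by Cauchy-Schwarz also their products,
   so the expectations in centered and cov are genuine.  For n = 1 there is no pair (a_{12}, a_{21})
   and cov is void. *)
locale elliptic_matrix = prob_space M
  for M :: "'w measure" and n :: nat and t :: real and A :: "'w \<Rightarrow> complex mat" +
  assumes dim: "\<omega> \<in> space M \<Longrightarrow> A \<omega> \<in> carrier_mat n n"
    and iid_pairs: "iid_vars borel (entry_pair A) (pair_indices n)"
    and iid_diag: "iid_vars borel (diag_entry A) {..<n}"
    and indep_pairs_diag: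
      "indep_families borel (entry_pair A) (pair_indices n) borel (diag_entry A) {..<n}"
    and second_moment:
      "i < n \<Longrightarrow> j < n \<Longrightarrow> integrable M (\<lambda>\<omega>. (cmod (A \<omega> $$ (i, j)))\<^sup>2)"
    and centered: "i < n \<Longrightarrow> j < n \<Longrightarrow> expectation (\<lambda>\<omega>. A \<omega> $$ (i, j)) = 0"
    and cov: "2 \<le> n \<Longrightarrow> expectation (\<lambda>\<omega>. A \<omega> $$ (0, 1) * A \<omega> $$ (1, 0)) = of_real t"

definition normalized_char_poly :: "nat \<Rightarrow> real \<Rightarrow> complex \<Rightarrow> complex mat \<Rightarrow> complex" where
  "normalized_char_poly n t z B =
     Determinant.det ((1 + of_real t * z\<^sup>2) \<cdot>\<^sub>m 1\<^sub>m n - (z / of_real (sqrt (real n))) \<cdot>\<^sub>m B)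
       * exp (- (of_nat n * of_real t * z\<^sup>2 / 2))"

end

theory Submission
  imports Defs
begin

text \<open>
  In the Leibniz expansion of the determinant only the involutions survive the expectation: a fixed
  point contributes \<open>a = 1 + t z\<^sup>2\<close>, a 2-cycle contributes \<open>- t z\<^sup>2 / n\<close>, and a longer cycle contains an
  entry that is centered and independent of the other factors.  Hence the expected determinant is
  a Hermite polynomial in \<open>a\<close> with variance \<open>\<kappa> = w / n\<close>, where \<open>w = t z\<^sup>2\<close>.

  Formally, with \<open>G\<close> a standard Gaussian, it equals the expectation of \<open>(1 + w + \<i> \<surd>\<kappa> G)\<^sup>n\<close>.  Shifting the
  contour to the saddle point \<open>\<i> \<surd>w\<close> absorbs the factor \<open>exp (- n w / 2)\<close> and leaves the expectation of
  \<open>((1 + y) exp (- y))\<^sup>n\<close> at \<open>y = \<i> \<surd>\<kappa> G\<close>.  This is checked on power series: both sides satisfy the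
  Hermite recursion, by Gaussian integration by parts.  The elementary bound
  \<open>\<bar>(1 + y) exp (- y)\<bar> \<le> exp (\<bar>y\<bar>\<^sup>2 / 2)\<close> dominates the coefficients of the resulting power series in \<open>w\<close> by
  \<open>e (k + 1)\<close>, uniformly in \<open>n\<close>; these coefficients converge to those of \<open>(1 - w) powr (- 1 / 2)\<close>, and
  Tannery's theorem gives uniform convergence on smaller discs.
\<close>

subsection \<open>Weighted sums over involutions\<close>

text \<open>For real \<open>\<kappa> > 0\<close> this is \<open>\<kappa> powr (m / 2)\<close> times
  the probabilists' Hermite polynomial of degree \<open>m\<close> at
  \<open>a / sqrt \<kappa>\<close>; the recursion avoids the root.\<close>

fun hermite :: "complex \<Rightarrow> complex \<Rightarrow> nat \<Rightarrow> complex" where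
  "hermite a \<kappa> 0 = 1"
| "hermite a \<kappa> (Suc 0) = a"
| "hermite a \<kappa> (Suc (Suc m)) = a * hermite a \<kappa> (Suc m) - \<kappa> * of_nat (Suc m) * hermite a \<kappa> m"

text \<open>
  Both elements of a 2-cycle receive the factor \<open>\<beta>\<close>, so a 2-cycle contributes \<open>\<beta>\<^sup>2\<close>.  Spreading the
  weight over the elements, at the price of a square root, avoids a choice of representatives.
\<close>

definition involution_factor :: "complex \<Rightarrow> complex \<Rightarrow> ('a \<Rightarrow> 'a) \<Rightarrow> 'a \<Rightarrow> complex" where
  "involution_factor a \<beta> \<sigma> i = (if \<sigma> i = i then a else if \<sigma> (\<sigma> i) = i then \<beta> else 0)"

definition involution_sum :: "complex \<Rightarrow> complex \<Rightarrow> 'a set \<Rightarrow> complex" where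
  "involution_sum a \<beta> S =
     (\<Sum>\<sigma> | \<sigma> permutes S. of_int (sign \<sigma>) * (\<Prod>i\<in>S. involution_factor a \<beta> \<sigma> i))"

text \<open>Split by the image \<open>y\<close> of the new point \<open>x\<close>. Either
  \<open>x\<close> is fixed, or its weight vanishes unless \<open>y\<close> returns to
  \<open>x\<close>; the 2-cycle then splits off, and its transposition gives the minus sign.\<close>

lemma involution_sum_insert:
  assumes S: "finite S" "x \<notin> S"
  shows "involution_sum a \<beta> (insert x S) =
    a * involution_sum a \<beta> S - \<beta>\<^sup>2 * (\<Sum>y\<in>S. involution_sum a \<beta> (S - {y}))"
proof -
  let ?e = "involution_factor a \<beta>"
  let ?f = "\<lambda>\<sigma>. of_int (sign \<sigma>) * (\<Prod>i\<in>insert x S. ?e \<sigma> i)"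
  have fixed: "(\<Sum>q | q permutes S. ?f (Transposition.transpose x x \<circ> q)) = a * involution_sum a \<beta> S"
    unfolding involution_sum_def sum_distrib_left
  proof (rule sum.cong[OF refl])
    fix q assume "q \<in> {q. q permutes S}"
    then have "q x = x" using S(2) by (auto simp: permutes_def)
    then show "?f (Transposition.transpose x x \<circ> q) = a * (of_int (sign q) * (\<Prod>i\<in>S. ?e q i))"
      using S by (simp add: involution_factor_def algebra_simps)
  qed
  have swapped: "(\<Sum>q | q permutes S. ?f (Transposition.transpose x y \<circ> q)) =
      - (\<beta>\<^sup>2 * involution_sum a \<beta> (S - {y}))" if y: "y \<in> S" for y
  proof -
    have xy: "x \<noteq> y" using y S(2) by auto
    have sub: "{q. q permutes S - {y}} \<subseteq> {q. q permutes S}"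
      using permutes_subset[of _ "S - {y}" S] by auto
    \<comment> \<open>Only permutations with \<open>q y = y\<close> survive: otherwise the composite
      sends \<open>x\<close> to \<open>y\<close> and \<open>y\<close> to \<open>q y\<close>, which
      differs from \<open>x\<close>, so \<open>x\<close> gets the factor 0.\<close>
    have "(\<Sum>q | q permutes S. ?f (Transposition.transpose x y \<circ> q)) =
        (\<Sum>q | q permutes S - {y}. ?f (Transposition.transpose x y \<circ> q))"
    proof (rule sum.mono_neutral_right[OF finite_permutations[OF S(1)] sub], rule ballI)
      fix q assume q: "q \<in> {q. q permutes S} - {q. q permutes S - {y}}"
      have qx: "q x = x" using q S(2) by (auto simp: permutes_def)
      have qy: "q y \<noteq> y"
        using q permutes_superset[of q S "S - {y}"] by auto
      have "q y \<noteq> x" using q qx xy by (metis DiffD1 mem_Collect_eq permutes_def)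
      then have "?e (Transposition.transpose x y \<circ> q) x = 0"
        using qx qy xy by (auto simp: involution_factor_def transpose_def)
      then show "?f (Transposition.transpose x y \<circ> q) = 0" using S(1) by simp
    qed
    also have "\<dots> = (\<Sum>q | q permutes S - {y}. - (\<beta>\<^sup>2 * (of_int (sign q) * (\<Prod>i\<in>S - {y}. ?e q i))))"
    proof (rule sum.cong[OF refl])
      fix q assume "q \<in> {q. q permutes S - {y}}"
      then have q: "q permutes S - {y}" by simp
      have qx: "q x = x" and qy: "q y = y" using q S(2) by (auto simp: permutes_def)
      have bij: "inj q" using q permutes_inj by blast
      have perm: "permutation q" using q S(1) by (auto simp: permutation_permutes)
      have sgn: "sign (Transposition.transpose x y \<circ> q) = - sign q"
        using perm xy by (simp add: sign_compose permutation_swap_id sign_swap_id)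
      have rest: "?e (Transposition.transpose x y \<circ> q) i = ?e q i" if i: "i \<in> S - {y}" for i
      proof -
        have qi: "q i \<in> S - {y}" using permutes_in_image[OF q] i by blast
        then have qqi: "q (q i) \<in> S - {y}" using permutes_in_image[OF q] by blast
        have "(Transposition.transpose x y \<circ> q) i = q i"
          using qi S(2) by (metis DiffE comp_apply insertI1 transpose_apply_other)
        moreover have "(Transposition.transpose x y \<circ> q) (q i) = q (q i)"
          using qqi S(2) by (metis DiffE comp_apply insertI1 transpose_apply_other)
        ultimately show ?thesis by (simp add: involution_factor_def)
      qed
      have ends: "?e (Transposition.transpose x y \<circ> q) x = \<beta>" "?e (Transposition.transpose x y \<circ> q) y = \<beta>"
        using qx qy xy by (auto simp: involution_factor_def)
      have "(\<Prod>i\<in>insert x S. ?e (Transposition.transpose x y \<circ> q) i) = \<beta> * (\<beta> * (\<Prod>i\<in>S - {y}. ?e q i))"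
        using S y ends rest by (simp add: prod.remove[of S y])
      then show "?f (Transposition.transpose x y \<circ> q) = - (\<beta>\<^sup>2 * (of_int (sign q) * (\<Prod>i\<in>S - {y}. ?e q i)))"
        using sgn by (simp add: power2_eq_square algebra_simps)
    qed
    finally show ?thesis
      by (simp add: involution_sum_def sum_negf sum_distrib_left)
  qed
  have "involution_sum a \<beta> (insert x S) =
      (\<Sum>y\<in>insert x S. \<Sum>q | q permutes S. ?f (Transposition.transpose x y \<circ> q))"
    unfolding involution_sum_def by (rule sum_over_permutations_insert[OF S])
  also have "\<dots> = a * involution_sum a \<beta> S - \<beta>\<^sup>2 * (\<Sum>y\<in>S. involution_sum a \<beta> (S - {y}))"
    using S fixed swapped by (simp add: sum_negf sum_distrib_left)
  finally show ?thesis .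
qed

lemma involution_sum_eq_hermite:
  "finite S \<Longrightarrow> involution_sum a \<beta> S = hermite a (\<beta>\<^sup>2) (card S)"
proof (induction "card S" arbitrary: S rule: less_induct)
  case less
  show ?case
  proof (cases "S = {}")
    case True
    then show ?thesis by (simp add: involution_sum_def)
  next
    case False
    then obtain x T where xT: "S = insert x T" "x \<notin> T"
      by (metis all_not_in_conv Set.set_insert)
    with less.prems have T: "finite T" by simp
    have IH_T: "involution_sum a \<beta> T = hermite a (\<beta>\<^sup>2) (card T)"
      using less.hyps[of T] xT T by simp
    have IH_rem: "involution_sum a \<beta> (T - {y}) = hermite a (\<beta>\<^sup>2) (card T - 1)" if "y \<in> T" for y
    proof -
      have "card (T - {y}) < card S"
        using card_Diff1_le[of T y] xT T by simp
      then show ?thesis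
        using less.hyps[of "T - {y}"] T that by simp
    qed
    \<comment> \<open>For \<open>card T = 0\<close> the truncated \<open>card T - 1\<close> is
      harmless, being multiplied by \<open>card T\<close>.\<close>
    have "involution_sum a \<beta> S = a * hermite a (\<beta>\<^sup>2) (card T)
        - \<beta>\<^sup>2 * (of_nat (card T) * hermite a (\<beta>\<^sup>2) (card T - 1))"
      using involution_sum_insert[OF T xT(2)] IH_T IH_rem xT(1) by simp
    also have "\<dots> = hermite a (\<beta>\<^sup>2) (card S)"
      using xT T by (cases "card T") (simp_all add: algebra_simps)
    finally show ?thesis .
  qed
qed

subsection \<open>Formal Gaussian expectation\<close>

text \<open>The double factorial (2 k - 1)!!.\<close>

fun odd_fact :: "nat \<Rightarrow> nat" where
  "odd_fact 0 = 1"
| "odd_fact (Suc k) = (2 * k + 1) * odd_fact k"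

lemma fact_double: "fact (2 * k) = odd_fact k * 2 ^ k * (fact k :: nat)"
  by (induction k) (simp_all add: algebra_simps)

text \<open>
  Since \<open>odd_fact k\<close> is the moment of order \<open>2 k\<close> of a standard Gaussian \<open>G\<close>, this is the expectation of
  \<open>f (\<i> \<surd>\<kappa> G)\<close>, computed term by term.
\<close>

definition gauss_functional :: "complex \<Rightarrow> complex fps \<Rightarrow> complex" where
  "gauss_functional \<kappa> f = (\<Sum>k. fps_nth f (2 * k) * of_nat (odd_fact k) * (- \<kappa>) ^ k)"

text \<open>These are the series of entire functions of exponential type. Since
  \<open>odd_fact k / fact (2 * k) = 1 / (2 ^ k * fact k)\<close>, the functional is dominated by an
  exponential series on them.\<close>

definition exp_bounded :: "complex fps \<Rightarrow> bool" where
  "exp_bounded f \<longleftrightarrow> (\<exists>C R. 0 \<le> C \<and> 0 \<le> R \<and> (\<forall>m. norm (fps_nth f m) \<le> C * R ^ m / fact m))"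

lemma exp_boundedI:
  "0 \<le> C \<Longrightarrow> 0 \<le> R \<Longrightarrow> (\<And>m. norm (fps_nth f m) \<le> C * R ^ m / fact m) \<Longrightarrow> exp_bounded f"
  unfolding exp_bounded_def by blast

lemma exp_bounded_exp: "exp_bounded (fps_exp s)"
  by (rule exp_boundedI[of 1 "norm s"]) (simp_all add: norm_divide norm_power)

lemma exp_bounded_add:
  assumes "exp_bounded f" "exp_bounded g"
  shows "exp_bounded (f + g)"
proof -
  from assms obtain C R D Q where
    f: "0 \<le> C" "0 \<le> R" "\<And>m. norm (fps_nth f m) \<le> C * R ^ m / fact m" and
    g: "0 \<le> D" "0 \<le> Q" "\<And>m. norm (fps_nth g m) \<le> D * Q ^ m / fact m"
    unfolding exp_bounded_def by blast
  show ?thesis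
  proof (rule exp_boundedI[of "C + D" "max R Q"])
    fix m
    have "norm (fps_nth (f + g) m) \<le> C * R ^ m / fact m + D * Q ^ m / fact m"
      using norm_triangle_mono[OF f(3) g(3)] by simp
    also have "\<dots> \<le> C * max R Q ^ m / fact m + D * max R Q ^ m / fact m"
      using f g by (intro add_mono divide_right_mono mult_left_mono power_mono) auto
    finally show "norm (fps_nth (f + g) m) \<le> (C + D) * max R Q ^ m / fact m"
      by (simp add: add_divide_distrib ring_distribs)
  qed (use f g in auto)
qed

lemma exp_bounded_const_mult:
  assumes "exp_bounded f"
  shows "exp_bounded (fps_const c * f)"
proof -
  from assms obtain C R where
    f: "0 \<le> C" "0 \<le> R" "\<And>m. norm (fps_nth f m) \<le> C * R ^ m / fact m"
    unfolding exp_bounded_def by blast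
  show ?thesis
  proof (rule exp_boundedI[of "norm c * C" R])
    show "norm (fps_nth (fps_const c * f) m) \<le> norm c * C * R ^ m / fact m" for m
      using mult_left_mono[OF f(3)[of m], of "norm c"] by (simp add: norm_mult mult.assoc)
  qed (use f in auto)
qed

text \<open>The index shift costs a factor \<open>m \<le> 2 ^ m\<close>, absorbed by doubling the
  radius; \<open>R + 1\<close> in place of \<open>R\<close> supplies the missing power even when
  \<open>R < 1\<close>.\<close>

lemma exp_bounded_X_mult:
  assumes "exp_bounded f"
  shows "exp_bounded (fps_X * f)"
proof -
  from assms obtain C R where
    f: "0 \<le> C" "0 \<le> R" "\<And>m. norm (fps_nth f m) \<le> C * R ^ m / fact m"
    unfolding exp_bounded_def by blast
  show ?thesis
  proof (rule exp_boundedI[of "C" "2 * (R + 1)"])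
    fix m
    show "norm (fps_nth (fps_X * f) m) \<le> C * (2 * (R + 1)) ^ m / fact m"
    proof (cases m)
      case (Suc j)
      have "real (Suc j) \<le> 2 ^ Suc j" by (rule less_imp_le[OF of_nat_less_two_power])
      moreover have "R ^ j \<le> (R + 1) ^ Suc j"
      proof -
        have "R ^ j * 1 \<le> (R + 1) ^ j * (R + 1)"
          using f by (intro mult_mono power_mono) auto
        then show ?thesis by (simp add: mult.commute)
      qed
      ultimately have "real (Suc j) * R ^ j \<le> 2 ^ Suc j * (R + 1) ^ Suc j"
        using f by (intro mult_mono) auto
      then have "C * (real (Suc j) * R ^ j) / fact (Suc j) \<le> C * (2 * (R + 1)) ^ Suc j / fact (Suc j)"
        unfolding power_mult_distrib[of 2] using f by (intro divide_right_mono mult_left_mono) auto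
      moreover have "C * (real (Suc j) * R ^ j) / fact (Suc j) = C * R ^ j / fact j"
        by (simp add: divide_simps)
      ultimately show ?thesis
        using f(3)[of j] Suc by simp
    qed (use f in auto)
  qed (use f in auto)
qed

lemma summable_gauss_functional:
  assumes "exp_bounded f"
  shows "summable (\<lambda>k. fps_nth f (2 * k) * of_nat (odd_fact k) * (- \<kappa>) ^ k)"
proof -
  from assms obtain C R where
    f: "0 \<le> C" "0 \<le> R" "\<And>m. norm (fps_nth f m) \<le> C * R ^ m / fact m"
    unfolding exp_bounded_def by blast
  have "summable (\<lambda>k. C * ((R\<^sup>2 * norm \<kappa> / 2) ^ k /\<^sub>R fact k))"
    by (intro summable_mult summable_exp_generic)
  then show ?thesis
  proof (rule summable_comparison_test[OF _ , rotated], intro exI[of _ 0] allI impI)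
    fix k
    have fd: "real (odd_fact k) = fact (2 * k) / (2 ^ k * fact k)"
    proof -
      have "(fact (2 * k) :: real) = real (fact (2 * k))" by simp
      also have "\<dots> = real (odd_fact k) * (2 ^ k * fact k)"
        unfolding fact_double by simp
      finally show ?thesis by simp
    qed
    have "norm (fps_nth f (2 * k) * of_nat (odd_fact k) * (- \<kappa>) ^ k) =
        norm (fps_nth f (2 * k)) * real (odd_fact k) * norm \<kappa> ^ k"
      by (simp add: norm_mult norm_power)
    also have "\<dots> \<le> C * R ^ (2 * k) / fact (2 * k) * real (odd_fact k) * norm \<kappa> ^ k"
      by (intro mult_right_mono f) auto
    also have "\<dots> = C * ((R\<^sup>2 * norm \<kappa> / 2) ^ k /\<^sub>R fact k)"
      unfolding fd power_mult[of R] power_mult_distrib power_divide by (simp add: divide_simps)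
    finally show "norm (fps_nth f (2 * k) * of_nat (odd_fact k) * (- \<kappa>) ^ k)
        \<le> C * ((R\<^sup>2 * norm \<kappa> / 2) ^ k /\<^sub>R fact k)" .
  qed
qed

lemma gauss_functional_add:
  assumes "exp_bounded f" "exp_bounded g"
  shows "gauss_functional \<kappa> (f + g) = gauss_functional \<kappa> f + gauss_functional \<kappa> g"
  unfolding gauss_functional_def
  using suminf_add[OF summable_gauss_functional[OF assms(1)] summable_gauss_functional[OF assms(2)]]
  by (simp add: ring_distribs)

lemma gauss_functional_const_mult:
  assumes "exp_bounded f"
  shows "gauss_functional \<kappa> (fps_const c * f) = c * gauss_functional \<kappa> f"
  unfolding gauss_functional_def
  using suminf_mult[OF summable_gauss_functional[OF assms]]
  by (simp add: mult.assoc)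

lemma gauss_functional_exp: "gauss_functional \<kappa> (fps_exp s) = exp (- (\<kappa> * s\<^sup>2 / 2))"
proof -
  have "fps_nth (fps_exp s) (2 * k) * of_nat (odd_fact k) * (- \<kappa>) ^ k = (- (\<kappa> * s\<^sup>2 / 2)) ^ k /\<^sub>R fact k" for k
  proof -
    have "(fact (2 * k) :: complex) = of_nat (fact (2 * k))" by simp
    also have "\<dots> = of_nat (odd_fact k) * (2 ^ k * fact k)"
      unfolding fact_double by simp
    finally have fd: "(fact (2 * k) :: complex) = of_nat (odd_fact k) * (2 ^ k * fact k)" .
    have "odd_fact k \<noteq> 0" by (induction k) auto
    have "(- (\<kappa> * s\<^sup>2 / 2)) ^ k = (- \<kappa>) ^ k * (s\<^sup>2) ^ k / 2 ^ k"
      by (simp flip: power_mult_distrib power_divide)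
    then show ?thesis
      unfolding fps_exp_nth of_nat_fact fd power_mult[of s]
      using \<open>odd_fact k \<noteq> 0\<close> by (simp add: scaleR_conv_of_real divide_simps)
  qed
  then show ?thesis
    by (simp add: gauss_functional_def exp_def)
qed

text \<open>Gaussian integration by parts.\<close>

lemma gauss_functional_X_mult:
  assumes "exp_bounded f"
  shows "gauss_functional \<kappa> (fps_X * f) = - \<kappa> * gauss_functional \<kappa> (fps_deriv f)"
proof -
  let ?a = "\<lambda>k. fps_nth (fps_X * f) (2 * k) * of_nat (odd_fact k) * (- \<kappa>) ^ k"
  let ?b = "\<lambda>k. fps_nth (fps_deriv f) (2 * k) * of_nat (odd_fact k) * (- \<kappa>) ^ k"
  have sm: "summable ?a"
    by (rule summable_gauss_functional[OF exp_bounded_X_mult[OF assms]])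
  \<comment> \<open>The factor \<open>2 * k + 1\<close> in the recursion of \<open>odd_fact\<close>
    is the one that differentiation produces.\<close>
  have ab: "?a (Suc k) = - \<kappa> * ?b k" for k
    by (simp add: algebra_simps)
  have "suminf ?a = (\<Sum>k. ?a (Suc k))"
    using suminf_split_head[OF sm] by simp
  also have "\<dots> = (\<Sum>k. - \<kappa> * ?b k)" unfolding ab ..
  also have "\<dots> = - \<kappa> * suminf ?b"
  \<comment> \<open>Summability of \<open>?b\<close> comes from that of \<open>?a\<close> after
    division by \<open>\<kappa>\<close>; for \<open>\<kappa> = 0\<close> both sides vanish.\<close>
  proof (cases "\<kappa> = 0")
    case False
    have "summable (\<lambda>k. - \<kappa> * ?b k)"
      using sm summable_Suc_iff[of ?a] unfolding ab by simp
    then have "summable (\<lambda>k. - (1 / \<kappa>) * (- \<kappa> * ?b k))" by (rule summable_mult)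
    then have "summable ?b" using False by simp
    then show ?thesis by (rule suminf_mult)
  qed simp
  finally show ?thesis unfolding gauss_functional_def .
qed

lemma exp_bounded_power_mult_exp: "exp_bounded ((1 + fps_X) ^ j * fps_exp s)"
proof (induction j)
  case (Suc j)
  have "(1 + fps_X) ^ Suc j * fps_exp s =
      (1 + fps_X) ^ j * fps_exp s + fps_X * ((1 + fps_X) ^ j * fps_exp s)"
    by (simp add: algebra_simps)
  then show ?case using Suc exp_bounded_add exp_bounded_X_mult by metis
qed (simp add: exp_bounded_exp)

text \<open>Multiplying by \<open>1 + fps_X\<close> and integrating by parts reproduces the Hermite
  recursion; the derivative of the exponential contributes \<open>s\<close>, which shifts the
  argument from \<open>1\<close> to \<open>1 - \<kappa> * s\<close>.\<close>

lemma gauss_functional_hermite: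
  "gauss_functional \<kappa> ((1 + fps_X) ^ j * fps_exp s) =
     exp (- (\<kappa> * s\<^sup>2 / 2)) * hermite (1 - \<kappa> * s) \<kappa> j"
proof (induction j rule: less_induct)
  case (less j)
  let ?G = "\<lambda>j. (1 + fps_X) ^ j * fps_exp s"
  let ?L = "gauss_functional \<kappa>"
  have step: "?L (?G (Suc j)) = (1 - \<kappa> * s) * ?L (?G j) - \<kappa> * of_nat j * ?L (?G (j - 1))" for j
  proof -
    have "?L (?G (Suc j)) = ?L (?G j + fps_X * ?G j)" by (simp add: algebra_simps)
    also have "\<dots> = ?L (?G j) - \<kappa> * ?L (fps_deriv (?G j))"
      by (simp add: gauss_functional_add gauss_functional_X_mult
        exp_bounded_power_mult_exp exp_bounded_X_mult)
    also have "fps_deriv (?G j) = fps_const (of_nat j) * ?G (j - 1) + fps_const s * ?G j"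
      by (simp add: fps_deriv_power algebra_simps)
    also have "?L \<dots> = of_nat j * ?L (?G (j - 1)) + s * ?L (?G j)"
      by (simp only: gauss_functional_add gauss_functional_const_mult
        exp_bounded_power_mult_exp exp_bounded_const_mult)
    finally show ?thesis by (simp add: algebra_simps)
  qed
  consider "j = 0" | "j = Suc 0" | i where "j = Suc (Suc i)"
    by (metis not0_implies_Suc)
  then show ?case
  proof cases
    case 1
    then show ?thesis by (simp add: gauss_functional_exp)
  next
    case 2
    then show ?thesis using step[of 0] by (simp add: gauss_functional_exp)
  next
    case 3
    then show ?thesis
      using step[of "Suc i"] less[of "Suc i"] less[of i] by (simp add: algebra_simps)
  qed
qed

subsection \<open>Asymptotics of the Hermite polynomials\<close>

text \<open>The coefficient of \<open>w ^ k\<close> when the functional with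
  \<open>\<kappa> = w / n\<close> is applied to the series of ((1 + y) exp (- y))^n.\<close>

definition hermite_coeff :: "nat \<Rightarrow> nat \<Rightarrow> complex" where
  "hermite_coeff n k = (- 1 / of_nat n) ^ k * of_nat (odd_fact k) *
     fps_nth ((1 + fps_X) ^ n * fps_exp (- of_nat n)) (2 * k)"

text \<open>With \<open>s = - n\<close> and \<open>\<kappa> = w / n\<close> one has
  \<open>1 - \<kappa> * s = 1 + w\<close> and \<open>\<kappa> * s\<^sup>2 / 2 = n * w / 2\<close>,
  so the prefactor of the functional is exactly the normalising exponential.\<close>

lemma hermite_eq_suminf:
  assumes "n > 0"
  shows "hermite (1 + w) (w / of_nat n) n * exp (- (of_nat n * w / 2)) = (\<Sum>k. hermite_coeff n k * w ^ k)"
    and "summable (\<lambda>k. hermite_coeff n k * w ^ k)"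
proof -
  have eq: "fps_nth ((1 + fps_X) ^ n * fps_exp (- of_nat n)) (2 * k) * of_nat (odd_fact k) * (- (w / of_nat n)) ^ k
      = hermite_coeff n k * w ^ k" for k
    using power_mult_distrib[of "- 1 / of_nat n" w k]
    by (simp add: hermite_coeff_def)
  have "hermite (1 + w) (w / of_nat n) n * exp (- (of_nat n * w / 2)) =
      gauss_functional (w / of_nat n) ((1 + fps_X) ^ n * fps_exp (- of_nat n))"
    unfolding gauss_functional_hermite using assms
    by (simp add: power2_eq_square mult.commute)
  then show "hermite (1 + w) (w / of_nat n) n * exp (- (of_nat n * w / 2)) = (\<Sum>k. hermite_coeff n k * w ^ k)"
    unfolding gauss_functional_def eq .
  show "summable (\<lambda>k. hermite_coeff n k * w ^ k)"
    using summable_gauss_functional[OF exp_bounded_power_mult_exp, of n "- of_nat n" "w / of_nat n"]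
    unfolding eq .
qed

section \<open>Coefficient bounds uniform in \<open>n\<close>, and coefficientwise limits\<close>

text \<open>Apply \<open>1 + x \<le> exp x\<close> to the square of the norm of
  \<open>1 + y\<close>, with \<open>x = 2 * Re y + (norm y)\<^sup>2\<close>; the factor
  \<open>exp (- y)\<close> cancels the linear part of the exponent.\<close>

lemma norm_one_plus_mult_exp_le: "norm ((1 + y) * exp (- y)) \<le> exp ((norm y)\<^sup>2 / 2)" for y :: complex
proof -
  have "(norm (1 + y))\<^sup>2 = 1 + (2 * Re y + (norm y)\<^sup>2)"
    by (simp add: cmod_power2 power2_sum algebra_simps)
  also have "\<dots> \<le> exp (2 * Re y + (norm y)\<^sup>2)" by (rule exp_ge_add_one_self)
  also have "\<dots> = (exp (Re y + (norm y)\<^sup>2 / 2))\<^sup>2"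
    by (simp add: power2_eq_square flip: exp_add)
  finally have "norm (1 + y) \<le> exp (Re y + (norm y)\<^sup>2 / 2)"
    by (rule power2_le_imp_le) simp
  then have "norm (1 + y) * exp (- Re y) \<le> exp (Re y + (norm y)\<^sup>2 / 2) * exp (- Re y)"
    by (rule mult_right_mono) simp
  also have "\<dots> = exp ((norm y)\<^sup>2 / 2)" by (simp flip: exp_add)
  finally show ?thesis by (simp add: norm_mult)
qed

text \<open>The radius \<open>\<surd>(2 k / n)\<close> in Cauchy's inequality minimises \<open>exp (n r\<^sup>2 / 2) / r ^ (2 k)\<close>.\<close>

lemma norm_hermite_fps_nth_le:
  assumes "n > 0" "k > 0"
  shows "norm (fps_nth ((1 + fps_X) ^ n * fps_exp (- of_nat n)) (2 * k) :: complex)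
     \<le> (exp 1 * real n / (2 * real k)) ^ k"
proof -
  define f where "f = (\<lambda>y::complex. (1 + y) ^ n * exp (- of_nat n * y))"
  define r where "r = sqrt (2 * real k / real n)"
  have r: "r > 0" "r\<^sup>2 = 2 * real k / real n" using assms by (auto simp: r_def)
  have "f has_fps_expansion (1 + fps_X) ^ n * fps_exp (- of_nat n)"
    unfolding f_def by (intro fps_expansion_intros)
  then have coeff: "fps_nth ((1 + fps_X) ^ n * fps_exp (- of_nat n)) (2 * k) = (deriv ^^ (2 * k)) f 0 / fact (2 * k)"
    by (rule fps_nth_fps_expansion)
  have "norm ((deriv ^^ (2 * k)) f 0) \<le> fact (2 * k) * exp (real k) / r ^ (2 * k)"
  proof (rule Cauchy_inequality[OF _ _ r(1)])
    show "f holomorphic_on ball 0 r" "continuous_on (cball 0 r) f"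
      unfolding f_def by (auto intro!: holomorphic_intros continuous_intros)
    fix y :: complex assume y: "norm (0 - y) = r"
    have "f y = ((1 + y) * exp (- y)) ^ n"
      by (simp add: f_def power_mult_distrib flip: exp_of_nat_mult)
    then have "norm (f y) = norm ((1 + y) * exp (- y)) ^ n" by (simp only: norm_power)
    also have "\<dots> \<le> exp ((norm y)\<^sup>2 / 2) ^ n"
      by (intro power_mono norm_one_plus_mult_exp_le) simp
    also have "\<dots> = exp (real k)"
      using y r(2) assms by (simp flip: exp_of_nat_mult)
    finally show "norm (f y) \<le> exp (real k)" .
  qed
  then have "norm (fps_nth ((1 + fps_X) ^ n * fps_exp (- of_nat n)) (2 * k) :: complex) \<le> exp (real k) / r ^ (2 * k)"
    unfolding coeff norm_divide by (simp add: pos_divide_le_eq mult_ac)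
  also have "\<dots> = (exp 1 * real n / (2 * real k)) ^ k"
    using assms exp_of_nat_mult[of k "1::real"]
    by (simp add: power_mult r(2) power_divide power_mult_distrib)
  finally show ?thesis .
qed

text \<open>This is \<open>(1 + 1 / k) ^ (k + 1) \<ge> exp 1\<close>, obtained from
  \<open>1 - x \<le> exp (- x)\<close> at \<open>x = 1 / (k + 1)\<close>.\<close>

lemma exp_one_le_power: "k > 0 \<Longrightarrow> exp 1 * real k ^ Suc k \<le> real (Suc k) ^ Suc k"
proof -
  assume k: "k > 0"
  have "real k / real (Suc k) = 1 + (- (1 / real (Suc k)))" by (simp add: field_simps)
  also have "\<dots> \<le> exp (- (1 / real (Suc k)))" by (rule exp_ge_add_one_self)
  finally have "(real k / real (Suc k)) ^ Suc k \<le> exp (- (1 / real (Suc k))) ^ Suc k"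
    by (rule power_mono) simp
  also have "\<dots> = exp (- 1)"
    by (subst exp_of_nat_mult[symmetric]) (simp add: field_simps)
  finally have "real k ^ Suc k / real (Suc k) ^ Suc k \<le> inverse (exp 1)"
    unfolding power_divide exp_minus .
  then have "real k ^ Suc k \<le> inverse (exp 1) * real (Suc k) ^ Suc k"
    by (subst (asm) pos_divide_le_eq) simp_all
  then have "exp 1 * real k ^ Suc k \<le> exp 1 * (inverse (exp 1) * real (Suc k) ^ Suc k)"
    by (rule mult_left_mono) simp
  then show ?thesis by (simp only: mult.assoc[symmetric] right_inverse[OF exp_not_eq_zero] mult_1_left)
qed

text \<open>A Stirling-type bound whose rate \<open>(2 * k / exp 1) ^ k\<close> matches the Cauchy
  estimate above, so that in the product only a factor linear in \<open>k\<close> is left.\<close>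

lemma odd_fact_le: "k > 0 \<Longrightarrow> real (odd_fact k) \<le> exp 1 * real k * (2 * real k / exp 1) ^ k"
proof (induction k rule: nat_induct_non_zero)
  case 1
  then show ?case by simp
next
  case (Suc k)
  have "real (odd_fact (Suc k)) \<le> (2 * real k + 1) * (exp 1 * real k * (2 * real k / exp 1) ^ k)"
    using mult_left_mono[OF Suc.IH, of "2 * real k + 1"] by (simp add: distrib_right)
  also have "\<dots> \<le> (2 * real (Suc k)) * (exp 1 * real k * (2 * real k / exp 1) ^ k)"
    by (intro mult_right_mono) auto
  also have "\<dots> = 2 * real (Suc k) * (2 / exp 1) ^ k * (exp 1 * real k ^ Suc k)"
    by (simp add: power_mult_distrib power_divide)
  also have "\<dots> \<le> 2 * real (Suc k) * (2 / exp 1) ^ k * real (Suc k) ^ Suc k"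
    using exp_one_le_power[OF Suc.hyps] by (intro mult_left_mono) auto
  also have "\<dots> = exp 1 * real (Suc k) * (2 * real (Suc k) / exp 1) ^ Suc k"
    unfolding power_Suc[of "2 * real (Suc k) / exp 1"] power_divide power_mult_distrib
    by (simp del: of_nat_Suc)
  finally show ?case .
qed

text \<open>Compare coefficients in the differential equation (1 + X) F' = - n X F satisfied by F =
  (1 + X)^n exp (- n X). The vanishing linear coefficient expresses that \<open>y = 0\<close> is the
  saddle point.\<close>

lemma hermite_fps_nth_rec:
  fixes n :: nat
  defines "u \<equiv> fps_nth ((1 + fps_X) ^ n * fps_exp (- of_nat n) :: complex fps)"
  shows "u 0 = 1" "u (Suc 0) = 0"
    "of_nat (Suc (Suc m)) * u (Suc (Suc m)) + of_nat (Suc m) * u (Suc m) = - of_nat n * u m"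
proof -
  define F :: "complex fps" where "F = (1 + fps_X) ^ n * fps_exp (- of_nat n)"
  have u: "u = fps_nth F" by (simp add: u_def F_def)
  have "(1 + fps_X) * fps_deriv F = - (fps_const (of_nat n) * (fps_X * F))"
  proof (cases n)
    case (Suc j)
    define c P E :: "complex fps" where "c = fps_const (of_nat n)"
      and "P = (1 + fps_X) ^ j" and "E = fps_exp (- of_nat n)"
    have F: "F = (1 + fps_X) * P * E"
      using Suc by (simp add: F_def P_def E_def)
    have dP: "fps_deriv ((1 + fps_X) * P) = c * P"
      using fps_deriv_power[of "1 + fps_X :: complex fps" n] Suc by (simp add: P_def c_def)
    have dE: "fps_deriv E = - (c * E)"
      by (simp add: E_def c_def flip: fps_const_neg)
    have dF: "fps_deriv F = (1 + fps_X) * P * (- (c * E)) + c * P * E"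
      unfolding F fps_deriv_mult[of "(1 + fps_X) * P" E] dP dE ..
    show ?thesis unfolding dF unfolding F c_def[symmetric] by (simp add: algebra_simps)
  qed (simp add: F_def)
  then have eq: "fps_nth (fps_deriv F + fps_X * fps_deriv F) m = fps_nth (- (fps_const (of_nat n) * (fps_X * F))) m" for m
    by (simp add: algebra_simps)
  show "u 0 = 1" by (simp add: u_def fps_nth_power_0)
  show "u (Suc 0) = 0" using eq[of 0] by (simp add: u)
  show "of_nat (Suc (Suc m)) * u (Suc (Suc m)) + of_nat (Suc m) * u (Suc m) = - of_nat n * u m"
    using eq[of "Suc m"] by (simp add: u)
qed

text \<open>The powers cancel because
  \<open>(1 / n) * (2 * k / exp 1) * (exp 1 * n / (2 * k)) = 1\<close>. For \<open>k = 0\<close>,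
  where neither estimate applies, the coefficient is 1.\<close>

lemma norm_hermite_coeff_le:
  assumes "n > 0"
  shows "norm (hermite_coeff n k) \<le> exp 1 * real (Suc k)"
proof (cases "k = 0")
  case True
  then show ?thesis by (simp add: hermite_coeff_def hermite_fps_nth_rec(1) del: fps_mult_nth_0)
next
  case False
  then have k: "k > 0" by simp
  have "norm (hermite_coeff n k) = (1 / real n) ^ k * real (odd_fact k) *
      norm (fps_nth ((1 + fps_X) ^ n * fps_exp (- of_nat n)) (2 * k) :: complex)"
    by (simp add: hermite_coeff_def norm_mult norm_power norm_divide)
  also have "\<dots> \<le> (1 / real n) ^ k * (exp 1 * real k * (2 * real k / exp 1) ^ k) *
      (exp 1 * real n / (2 * real k)) ^ k"
    using odd_fact_le[OF k] norm_hermite_fps_nth_le[OF assms k]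
    by (intro mult_mono mult_left_mono) auto
  also have "\<dots> = exp 1 * real k * ((1 / real n) * (2 * real k / exp 1) * (exp 1 * real n / (2 * real k))) ^ k"
    by (simp only: power_mult_distrib mult_ac)
  also have "(1 / real n) * (2 * real k / exp 1) * (exp 1 * real n / (2 * real k)) = 1"
    using assms k by simp
  finally show ?thesis
    by (simp add: algebra_simps order.trans[OF _ add_increasing])
qed

text \<open>
  With \<open>y = x / \<surd>n\<close>, the power series of \<open>(1 + y)\<^sup>n exp (- n y)\<close> in \<open>x\<close> converges coefficientwise to that
  of \<open>exp (- x\<^sup>2 / 2)\<close>, because the recursion of the coefficients does.
\<close>

lemma hermite_fps_nth_tendsto:
  "(\<lambda>n. fps_nth ((1 + fps_X) ^ n * fps_exp (- of_nat n)) (2 * k) / of_nat n ^ k)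
     \<longlonglongrightarrow> ((- 1 / 2) ^ k / fact k :: complex)"
proof -
  define v :: "nat \<Rightarrow> nat \<Rightarrow> complex" where
    "v m n = fps_nth ((1 + fps_X) ^ n * fps_exp (- of_nat n)) m / of_real (sqrt (real n)) ^ m" for m n
  have v0: "v 0 n = 1" and v1: "v (Suc 0) n = 0" for n
    by (simp_all only: v_def hermite_fps_nth_rec) simp_all
  \<comment> \<open>Division by \<open>sqrt n ^ (m + 2)\<close> turns the factor \<open>n\<close>
    into 1, while the neighbouring term keeps a factor \<open>1 / sqrt n\<close> that vanishes in
    the limit.\<close>
  have rec: "v (Suc (Suc m)) n = - (v m n + of_nat (Suc m) * v (Suc m) n * of_real (1 / sqrt (real n))) / of_nat (Suc (Suc m))"
    if n: "n > 0" for m n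
  proof -
    define u where "u = fps_nth ((1 + fps_X) ^ n * fps_exp (- of_nat n) :: complex fps)"
    define q where "q = complex_of_real (sqrt (real n))"
    have q: "q \<noteq> 0" "q * q = of_nat n" using n by (simp_all add: q_def flip: of_real_mult)
    have "of_nat (Suc (Suc m)) * u (Suc (Suc m)) = - (q * q) * u m - of_nat (Suc m) * u (Suc m)"
      using hermite_fps_nth_rec(3)[of m n] unfolding q(2) u_def[symmetric] by (simp only: eq_diff_eq)
    then have "of_nat (Suc (Suc m)) * (u (Suc (Suc m)) / q ^ Suc (Suc m)) =
       - (u m / q ^ m + of_nat (Suc m) * (u (Suc m) / q ^ Suc m) * (1 / q))"
      using q(1) by (simp add: field_simps del: of_nat_Suc)
    then have "of_nat (Suc (Suc m)) * v (Suc (Suc m)) n = - (v m n + of_nat (Suc m) * v (Suc m) n * of_real (1 / sqrt (real n)))"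
      unfolding v_def u_def[symmetric] q_def[symmetric] of_real_divide of_real_1 .
    then show ?thesis
      by (simp add: eq_divide_eq mult.commute del: of_nat_Suc)
  qed
  \<comment> \<open>Both parities go through the induction together, since \<open>v (m + 2)\<close>
    depends on \<open>v m\<close> and \<open>v (m + 1)\<close>.\<close>
  have "v (2 * k) \<longlonglongrightarrow> (- 1 / 2) ^ k / fact k \<and> v (Suc (2 * k)) \<longlonglongrightarrow> 0"
  proof (induction k)
    case 0
    then show ?case by (simp add: v0[abs_def] v1[abs_def] v0 v1)
  next
    case (Suc k)
    have sq: "(\<lambda>n. complex_of_real (1 / sqrt (real n))) \<longlonglongrightarrow> of_real 0"
      by (intro tendsto_of_real) real_asymp
    have step: "v (Suc (Suc m)) \<longlonglongrightarrow> - (x + of_nat (Suc m) * y * of_real 0) / of_nat (Suc (Suc m))"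
      if "v m \<longlonglongrightarrow> x" "v (Suc m) \<longlonglongrightarrow> y" for m x y
    proof (rule Lim_transform_eventually)
      show "(\<lambda>n. - (v m n + of_nat (Suc m) * v (Suc m) n * of_real (1 / sqrt (real n))) / of_nat (Suc (Suc m)))
        \<longlonglongrightarrow> - (x + of_nat (Suc m) * y * of_real 0) / of_nat (Suc (Suc m))"
        by (intro tendsto_divide tendsto_minus tendsto_add tendsto_mult tendsto_const that sq)
          (simp del: of_nat_Suc)
      show "eventually (\<lambda>n. - (v m n + of_nat (Suc m) * v (Suc m) n * of_real (1 / sqrt (real n))) / of_nat (Suc (Suc m)) = v (Suc (Suc m)) n) sequentially"
        using eventually_gt_at_top[of 0] by eventually_elim (simp only: rec)
    qed
    have e: "v (2 * Suc k) \<longlonglongrightarrow> - ((- 1 / 2) ^ k / fact k) / of_nat (Suc (Suc (2 * k)))"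
      using step[OF Suc.IH[THEN conjunct1] Suc.IH[THEN conjunct2]] by (simp del: of_nat_Suc)
    have "- ((- 1 / 2) ^ k / fact k) / of_nat (Suc (Suc (2 * k))) = ((- 1 / 2) ^ Suc k / fact (Suc k) :: complex)"
    proof -
      have "(of_nat (Suc (Suc (2 * k))) :: complex) = 2 * of_nat (Suc k)" by simp
      then show ?thesis by (simp del: of_nat_Suc)
    qed
    with e have e': "v (2 * Suc k) \<longlonglongrightarrow> (- 1 / 2) ^ Suc k / fact (Suc k)" by (simp only:)
    have o: "v (Suc (2 * Suc k)) \<longlonglongrightarrow> 0"
      using step[of "Suc (2 * k)" 0] Suc e' by simp
    from e' o show ?case by blast
  qed
  moreover have "complex_of_real (sqrt (real n)) ^ (2 * k) = of_nat n ^ k" for n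
    by (simp add: power_mult flip: of_real_power)
  ultimately show ?thesis by (simp add: v_def[abs_def])
qed

text \<open>The limit is (2 k - 1)!! / (2^k k!), the binomial coefficient of
  \<open>(1 - w) powr (- 1 / 2)\<close>: consecutive terms of both have ratio
  \<open>(2 * k + 1) / (2 * (k + 1))\<close>.\<close>

lemma hermite_coeff_tendsto:
  "(\<lambda>n. hermite_coeff n k) \<longlonglongrightarrow> (- 1) ^ k * ((- 1 / 2) gchoose k)"
proof -
  have lim: "of_nat (odd_fact k) * (- 1) ^ k * ((- 1 / 2) ^ k / fact k) = ((- 1) ^ k * ((- 1 / 2) gchoose k) :: complex)"
  proof (induction k)
    case (Suc k)
    have "((- 1 / 2) gchoose Suc k) * (2 * of_nat (Suc k)) = - ((2 * of_nat k + 1) * ((- 1 / 2) gchoose k) :: complex)"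
    proof -
      have "of_nat (Suc k) * ((- 1 / 2) gchoose Suc k) = (- 1 / 2 - of_nat k) * ((- 1 / 2) gchoose k :: complex)"
        by (simp only: gbinomial_absorption gbinomial_absorb_comp)
      then have "2 * (of_nat (Suc k) * ((- 1 / 2) gchoose Suc k)) = 2 * ((- 1 / 2 - of_nat k) * ((- 1 / 2) gchoose k :: complex))"
        by (rule arg_cong)
      then show ?thesis by (simp add: algebra_simps)
    qed
    then have gch: "((- 1 / 2) gchoose Suc k) = - ((2 * of_nat k + 1) * ((- 1 / 2) gchoose k) / (2 * of_nat (Suc k)) :: complex)"
      by (simp add: field_simps del: of_nat_Suc)
    have coeff: "of_nat (odd_fact (Suc k)) * (- 1) ^ Suc k * ((- 1 / 2) ^ Suc k / fact (Suc k)) =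
       (of_nat (odd_fact k) * (- 1) ^ k * ((- 1 / 2) ^ k / fact k)) * ((2 * of_nat k + 1) / (2 * of_nat (Suc k)) :: complex)"
      by (simp add: field_simps del: of_nat_Suc)
    show ?case unfolding coeff Suc.IH gch by simp
  qed simp
  have "hermite_coeff n k = of_nat (odd_fact k) * (- 1) ^ k *
      (fps_nth ((1 + fps_X) ^ n * fps_exp (- of_nat n)) (2 * k) / of_nat n ^ k)" for n
    unfolding hermite_coeff_def power_divide[of "- 1"] by simp
  then show ?thesis
    using tendsto_mult_left[OF hermite_fps_nth_tendsto[of k], of "of_nat (odd_fact k) * (- 1) ^ k"]
    unfolding lim by simp
qed

section \<open>Uniform convergence on smaller discs\<close>

lemma hermite_uniform_limit:
  assumes "r < 1"
  shows "uniform_limit (cball 0 r) (\<lambda>n w. hermite (1 + w) (w / of_nat n) n * exp (- (of_nat n * w / 2)))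
     (\<lambda>w. (1 - w) powr (- 1 / 2)) sequentially"
proof (cases "r \<ge> 0")
  case False
  then show ?thesis by simp
next
  case True
  define b :: "nat \<Rightarrow> complex" where "b k = (- 1) ^ k * ((- 1 / 2) gchoose k)" for k
  \<comment> \<open>\<open>d k n\<close> bounds the \<open>k\<close>-th term of the difference of
    the two series for all \<open>w\<close> in the disc at once; convergence of its sum to 0 is
    therefore uniform in \<open>w\<close>.\<close>
  define d where "d k n = norm (hermite_coeff n k - b k) * r ^ k" for k n
  \<comment> \<open>The bound passes to the limit coefficients, so \<open>d\<close> has a summable
    majorant free of \<open>n\<close>.\<close>
  have b_le: "norm (b k) \<le> exp 1 * real (Suc k)" for k
  proof (rule tendsto_upperbound)
    show "(\<lambda>n. norm (hermite_coeff n k)) \<longlonglongrightarrow> norm (b k)"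
      unfolding b_def by (intro tendsto_norm hermite_coeff_tendsto)
    show "eventually (\<lambda>n. norm (hermite_coeff n k) \<le> exp 1 * real (Suc k)) sequentially"
      using eventually_gt_at_top[of 0] by eventually_elim (rule norm_hermite_coeff_le)
  qed simp
  have d_le: "norm (d k n) \<le> 2 * exp 1 * (real (Suc k) * r ^ k)" if "n > 0" for k n
  proof -
    have "norm (hermite_coeff n k - b k) \<le> 2 * exp 1 * real (Suc k)"
      using norm_triangle_ineq4[of "hermite_coeff n k" "b k"] norm_hermite_coeff_le[OF that, of k] b_le[of k]
      by simp
    then show ?thesis
      using True unfolding d_def by (simp add: abs_mult mult_right_mono mult.assoc[symmetric])
  qed
  have sum_M: "summable (\<lambda>k. 2 * exp 1 * (real (Suc k) * r ^ k))"
    by (intro summable_mult sums_summable[OF geometric_deriv_sums]) (use True assms in auto)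
  have d_lim: "(\<lambda>n. d k n) \<longlonglongrightarrow> 0" for k
  proof -
    have "(\<lambda>n. norm (hermite_coeff n k - b k) * r ^ k) \<longlonglongrightarrow> norm (b k - b k) * r ^ k"
      unfolding b_def by (intro tendsto_intros hermite_coeff_tendsto)
    then show ?thesis by (simp add: d_def)
  qed
  have ev: "eventually (\<lambda>(k, n). norm (d k n) \<le> 2 * exp 1 * (real (Suc k) * r ^ k)) (at_top \<times>\<^sub>F sequentially)"
    unfolding case_prod_unfold
    by (rule eventually_mono[OF eventually_prodI[OF always_eventually eventually_gt_at_top[of 0]]])
      (use d_le in auto)
  have tan: "eventually (\<lambda>n. summable (\<lambda>k. norm (d k n))) sequentially"
    "(\<lambda>n. \<Sum>k. d k n) \<longlonglongrightarrow> 0"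
    using tannerys_theorem[OF d_lim ev sum_M] by auto
  show ?thesis
  proof (rule uniform_limitI)
    fix e :: real assume "e > 0"
    then have "eventually (\<lambda>n. (\<Sum>k. d k n) < e) sequentially"
      using order_tendstoD(2)[OF tan(2)] by blast
    then show "eventually (\<lambda>n. \<forall>w\<in>cball 0 r.
        dist (hermite (1 + w) (w / of_nat n) n * exp (- (of_nat n * w / 2))) ((1 - w) powr (- 1 / 2)) < e) sequentially"
      using tan(1) eventually_gt_at_top[of 0]
    proof eventually_elim
      case (elim n)
      show ?case
      proof
        fix w :: complex assume "w \<in> cball 0 r"
        then have w: "norm w \<le> r" by simp
        have lim: "(\<lambda>k. b k * w ^ k) sums ((1 - w) powr (- 1 / 2))"
        proof -
          have "(\<lambda>k. ((- 1 / 2) gchoose k) * (- w) ^ k) sums (1 + - w) powr (- 1 / 2)"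
            by (rule gen_binomial_complex) (use w assms in simp)
          moreover have "((- 1 / 2) gchoose k) * (- w) ^ k = b k * w ^ k" for k
            by (simp add: b_def power_minus[of w])
          ultimately show ?thesis by simp
        qed
        have "(\<lambda>k. hermite_coeff n k * w ^ k) sums (hermite (1 + w) (w / of_nat n) n * exp (- (of_nat n * w / 2)))"
          using hermite_eq_suminf[OF elim(3), of w] by (simp add: sums_iff)
        from sums_diff[OF this lim]
        have diff: "(\<lambda>k. (hermite_coeff n k - b k) * w ^ k) sums
          (hermite (1 + w) (w / of_nat n) n * exp (- (of_nat n * w / 2)) - (1 - w) powr (- 1 / 2))"
          by (simp add: ring_distribs)
        have "norm (\<Sum>k. (hermite_coeff n k - b k) * w ^ k) \<le> (\<Sum>k. d k n)"
        proof (rule norm_suminf_le)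
          show "norm ((hermite_coeff n k - b k) * w ^ k) \<le> d k n" for k
            unfolding d_def norm_mult norm_power by (intro mult_left_mono power_mono w) auto
          show "summable (\<lambda>k. d k n)" using summable_norm_cancel[OF elim(2)] .
        qed
        then show "dist (hermite (1 + w) (w / of_nat n) n * exp (- (of_nat n * w / 2))) ((1 - w) powr (- 1 / 2)) < e"
          using elim(1) diff by (simp add: dist_norm sums_iff)
      qed
    qed
  qed
qed

subsection \<open>The expected determinant\<close>

lemma finite_pair_indices [simp]: "finite (pair_indices n)"
  by (rule finite_subset[of _ "{..<n} \<times> {..<n}"]) (auto simp: pair_indices_def)

text \<open>Each \<open>i\<close> has \<open>i < \<sigma> i\<close>, \<open>\<sigma> i < i\<close>
  or \<open>\<sigma> i = i\<close>, so each factor belongs to exactly one unordered pair or diagonal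
  place. This groups the Leibniz product into independent blocks.\<close>

lemma prod_pair_indices:
  fixes h :: "nat \<Rightarrow> nat \<Rightarrow> 'b::comm_monoid_mult"
  assumes \<sigma>: "\<sigma> permutes {..<n}"
  shows "(\<Prod>(i, j)\<in>pair_indices n. (if \<sigma> i = j then h i j else 1) * (if \<sigma> j = i then h j i else 1))
      * (\<Prod>i<n. if \<sigma> i = i then h i i else 1) = (\<Prod>i<n. h i (\<sigma> i))"
proof -
  have lt: "\<sigma> i < n" if "i < n" for i using permutes_in_image[OF \<sigma>] that by auto
  have pairs: "pair_indices n = (SIGMA i:{..<n}. {i<..<n})"
    by (auto simp: pair_indices_def)
  \<comment> \<open>Enumerating by the larger index makes the inner product, for factors below the
    diagonal, run over the possible values of \<open>\<sigma> j\<close>.\<close>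
  have pairs': "pair_indices n = (\<lambda>(j, i). (i, j)) ` (SIGMA j:{..<n}. {..<j})"
    by (force simp: pair_indices_def)
  have up: "(\<Prod>(i, j)\<in>pair_indices n. if \<sigma> i = j then h i j else 1)
      = (\<Prod>i<n. if i < \<sigma> i then h i (\<sigma> i) else 1)"
    unfolding pairs by (subst prod.Sigma[symmetric]) (auto intro!: prod.cong simp: prod.delta lt)
  have down: "(\<Prod>(i, j)\<in>pair_indices n. if \<sigma> j = i then h j i else 1)
      = (\<Prod>j<n. if \<sigma> j < j then h j (\<sigma> j) else 1)"
  proof -
    have "(\<Prod>(i, j)\<in>pair_indices n. if \<sigma> j = i then h j i else 1)
        = (\<Prod>(j, i)\<in>(SIGMA j:{..<n}. {..<j}). if \<sigma> j = i then h j i else 1)"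
      unfolding pairs' by (subst prod.reindex) (auto intro!: prod.cong simp: inj_on_def)
    also have "\<dots> = (\<Prod>j<n. if \<sigma> j < j then h j (\<sigma> j) else 1)"
      by (subst prod.Sigma[symmetric]) (auto intro!: prod.cong simp: prod.delta lt)
    finally show ?thesis .
  qed
  have "(\<Prod>(i, j)\<in>pair_indices n. (if \<sigma> i = j then h i j else 1) * (if \<sigma> j = i then h j i else 1))
      = (\<Prod>i<n. if i < \<sigma> i then h i (\<sigma> i) else 1) * (\<Prod>j<n. if \<sigma> j < j then h j (\<sigma> j) else 1)"
    unfolding up[symmetric] down[symmetric] by (simp add: case_prod_unfold prod.distrib)
  then show ?thesis
    unfolding prod.distrib[symmetric] by (simp only:) (auto simp flip: prod.distrib intro!: prod.cong)
qed

lemma prod_pair_indices_involution: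
  assumes \<sigma>: "\<sigma> permutes {..<n}"
  shows "(\<Prod>(i, j)\<in>pair_indices n. if \<sigma> i = j \<and> \<sigma> j = i then \<beta>\<^sup>2 else if \<sigma> i = j \<or> \<sigma> j = i then 0 else 1)
      * (\<Prod>i<n. if \<sigma> i = i then a else 1) = (\<Prod>i<n. involution_factor a \<beta> \<sigma> i)"
    (is "prod ?m _ * _ = _")
proof (cases "\<forall>i<n. \<sigma> (\<sigma> i) = i")
  case True
  let ?h = "\<lambda>i j::nat. if i = j then a else \<beta>"
  have "prod ?m (pair_indices n) =
      (\<Prod>(i, j)\<in>pair_indices n. (if \<sigma> i = j then ?h i j else 1) * (if \<sigma> j = i then ?h j i else 1))"
    using True by (intro prod.cong) (auto simp: pair_indices_def power2_eq_square)
  moreover have "(\<Prod>i<n. if \<sigma> i = i then a else 1) = (\<Prod>i<n. if \<sigma> i = i then ?h i i else 1)"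
    by (intro prod.cong) auto
  moreover have "(\<Prod>i<n. involution_factor a \<beta> \<sigma> i) = (\<Prod>i<n. ?h i (\<sigma> i))"
    using True by (intro prod.cong) (auto simp: involution_factor_def)
  ultimately show ?thesis using prod_pair_indices[OF \<sigma>, of ?h] by simp
next
  case False
  then obtain i where i: "i < n" "\<sigma> (\<sigma> i) \<noteq> i" by blast
  then have ne: "\<sigma> i \<noteq> i" by auto
  have "\<sigma> i < n" using permutes_in_image[OF \<sigma>] i by auto
  \<comment> \<open>The pair formed by \<open>i\<close> and \<open>\<sigma> i\<close> is used in one
    direction only; \<open>min\<close> and \<open>max\<close> put it in the order of
    \<open>pair_indices\<close>.\<close>
  then have "(min i (\<sigma> i), max i (\<sigma> i)) \<in> pair_indices n"
    using i ne by (auto simp: pair_indices_def)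
  moreover have "?m (min i (\<sigma> i), max i (\<sigma> i)) = 0"
    using i ne by (auto simp: min_def max_def)
  ultimately have "prod ?m (pair_indices n) = 0"
    by (intro prod_zero[OF finite_pair_indices]) blast
  moreover have "(\<Prod>i<n. involution_factor a \<beta> \<sigma> i) = 0"
    using i ne by (intro prod_zero) (auto simp: involution_factor_def)
  ultimately show ?thesis by (simp only: mult_zero_left)
qed

section \<open>Independence and moments of the entries\<close>

text \<open>Variables measurable with respect to the generated sigma-algebras generate smaller ones,
  and independence passes down. It will separate the off-diagonal from the diagonal part of a
  Leibniz product.\<close>

lemma (in prob_space) indep_families_imp_indep_var:
  fixes N :: "'b measure" and L :: "'c measure"
  defines "gen \<equiv> \<lambda>X I. {X i -` B \<inter> space M | i B. i \<in> I \<and> B \<in> sets N}"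
    and "gen' \<equiv> \<lambda>Y J. {Y i -` B \<inter> space M | i B. i \<in> J \<and> B \<in> sets L}"
  assumes indep: "indep_families N X I L Y J"
    and f: "f \<in> measurable (sigma (space M) (gen X I)) S" 
    and g: "g \<in> measurable (sigma (space M) (gen' Y J)) T"
  shows "indep_var S f T g"
proof -
  have sub: "sigma_sets (space M) {h -` B \<inter> space M | B. B \<in> sets R} \<subseteq> sigma_sets (space M) G"
    if "h \<in> measurable (sigma (space M) G) R" "G \<subseteq> Pow (space M)" for h G and R :: "'x measure"
  proof (rule sigma_sets_mono, safe)
    fix B assume "B \<in> sets R"
    from measurable_sets[OF that(1) this] show "h -` B \<inter> space M \<in> sigma_sets (space M) G"
      using that(2) by (simp add: space_measure_of sets_measure_of)
  qed
  have Pow: "gen X I \<subseteq> Pow (space M)" "gen' Y J \<subseteq> Pow (space M)"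
    by (auto simp: gen_def gen'_def)
  have ind: "indep_set (sigma_sets (space M) (gen X I)) (sigma_sets (space M) (gen' Y J))"
    using indep unfolding indep_families_def gen_def gen'_def .
  have rv: "h \<in> measurable M R"
    if "h \<in> measurable (sigma (space M) G) R" "G \<subseteq> Pow (space M)" "sigma_sets (space M) G \<subseteq> events"
    for h G and R :: "'x measure"
  proof (rule measurableI)
    show "h x \<in> space R" if "x \<in> space M" for x
      using measurable_space[OF \<open>h \<in> measurable (sigma (space M) G) R\<close>] that
        \<open>G \<subseteq> Pow (space M)\<close> by (simp add: space_measure_of)
    show "h -` B \<inter> space M \<in> events" if "B \<in> sets R" for B
      using measurable_sets[OF \<open>h \<in> measurable (sigma (space M) G) R\<close> that]
        \<open>G \<subseteq> Pow (space M)\<close> \<open>sigma_sets (space M) G \<subseteq> events\<close>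
      by (auto simp: space_measure_of sets_measure_of)
  qed
  have mono: "indep_set (sigma_sets (space M) {f -` B \<inter> space M | B. B \<in> sets S})
      (sigma_sets (space M) {g -` B \<inter> space M | B. B \<in> sets T})"
    using ind sub[OF f Pow(1)] sub[OF g Pow(2)] unfolding indep_sets2_eq by blast
  show ?thesis
    unfolding indep_var_eq
    using mono rv[OF f Pow(1) indep_setD_ev1[OF ind]] rv[OF g Pow(2) indep_setD_ev2[OF ind]] by blast
qed

lemma measurable_sigma_family:
  assumes "i \<in> I" "X i \<in> space M \<rightarrow> space N"
  shows "X i \<in> measurable (sigma (space M) {X i -` B \<inter> space M | i B. i \<in> I \<and> B \<in> sets N}) N"
proof (rule measurableI)
  let ?G = "{X i -` B \<inter> space M | i B. i \<in> I \<and> B \<in> sets N}"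
  have G: "?G \<subseteq> Pow (space M)" by auto
  show "X i x \<in> space N" if "x \<in> space (sigma (space M) ?G)" for x
    using that assms G by (auto simp: space_measure_of)
  show "X i -` B \<inter> space (sigma (space M) ?G) \<in> sets (sigma (space M) ?G)" if "B \<in> sets N" for B
    using that assms(1) G by (auto simp: space_measure_of sets_measure_of intro!: sigma_sets.Basic)
qed

context elliptic_matrix
begin

lemma entry_pair_measurable: "p \<in> pair_indices n \<Longrightarrow> entry_pair A p \<in> borel_measurable M"
  using iid_pairs unfolding iid_vars_def indep_vars_def by blast

lemma entry_measurable:
  assumes "i < n" "j < n"
  shows "(\<lambda>\<omega>. A \<omega> $$ (i, j)) \<in> borel_measurable M"
proof -
  have pair: "(\<lambda>\<omega>. A \<omega> $$ (i, j)) \<in> borel_measurable M \<and> (\<lambda>\<omega>. A \<omega> $$ (j, i)) \<in> borel_measurable M"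
    if "i < j" "j < n" for i j
  proof -
    have m: "entry_pair A (i, j) \<in> borel_measurable M"
      using that by (intro entry_pair_measurable) (simp add: pair_indices_def)
    have "(\<lambda>\<omega>. fst (entry_pair A (i, j) \<omega>)) \<in> borel_measurable M"
      "(\<lambda>\<omega>. snd (entry_pair A (i, j) \<omega>)) \<in> borel_measurable M"
      using m by (auto intro!: borel_measurable_continuous_on[OF _ m] continuous_intros)
    then show ?thesis by (simp add: entry_pair_def)
  qed
  show ?thesis
  proof (cases i j rule: linorder_cases)
    case equal
    have "diag_entry A i \<in> borel_measurable M"
      using iid_diag assms unfolding iid_vars_def indep_vars_def by blast
    then show ?thesis using equal by (simp add: diag_entry_def[abs_def])
  qed (use pair assms in auto)
qed

lemma entry_integrable:
  assumes "i < n" "j < n"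
  shows "integrable M (\<lambda>\<omega>. A \<omega> $$ (i, j))"
proof (rule Bochner_Integration.integrable_bound)
  show "integrable M (\<lambda>\<omega>. 1 + (cmod (A \<omega> $$ (i, j)))\<^sup>2)"
    using second_moment[OF assms] by simp
  have "x \<le> 1 + x\<^sup>2" if "0 \<le> x" for x :: real
    using sum_power2_ge_zero[of "x - 1" 0] that by (simp add: power2_eq_square algebra_simps)
  then show "AE \<omega> in M. cmod (A \<omega> $$ (i, j)) \<le> norm (1 + (cmod (A \<omega> $$ (i, j)))\<^sup>2)"
    by (simp add: abs_of_nonneg)
qed (rule entry_measurable[OF assms])

lemma entry_mult_integrable:
  assumes "i < n" "j < n"
  shows "integrable M (\<lambda>\<omega>. A \<omega> $$ (i, j) * A \<omega> $$ (j, i))"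
proof (rule Bochner_Integration.integrable_bound)
  show "integrable M (\<lambda>\<omega>. (cmod (A \<omega> $$ (i, j)))\<^sup>2 + (cmod (A \<omega> $$ (j, i)))\<^sup>2)"
    using second_moment assms by simp
  have "x * y \<le> x\<^sup>2 + y\<^sup>2" if "0 \<le> x" "0 \<le> y" for x y :: real
    using sum_squares_bound[of x y] mult_nonneg_nonneg[OF that] by linarith
  then show "AE \<omega> in M. cmod (A \<omega> $$ (i, j) * A \<omega> $$ (j, i))
      \<le> norm ((cmod (A \<omega> $$ (i, j)))\<^sup>2 + (cmod (A \<omega> $$ (j, i)))\<^sup>2)"
    by (simp add: norm_mult)
qed (intro borel_measurable_times entry_measurable assms)

text \<open>The covariance is given for the first pair only; the common joint law of the pairs
  carries it to all others.\<close>

lemma expectation_entry_mult: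
  assumes "i < j" "j < n"
  shows "expectation (\<lambda>\<omega>. A \<omega> $$ (i, j) * A \<omega> $$ (j, i)) = of_real t"
proof -
  let ?f = "\<lambda>x :: complex \<times> complex. fst x * snd x"
  have f: "?f \<in> borel_measurable borel"
    by (intro borel_measurable_continuous_onI continuous_intros)
  have p: "(i, j) \<in> pair_indices n" "(0, 1) \<in> pair_indices n"
    using assms by (auto simp: pair_indices_def)
  have "expectation (\<lambda>\<omega>. ?f (entry_pair A (i, j) \<omega>)) = integral\<^sup>L (distr M borel (entry_pair A (i, j))) ?f"
    by (rule integral_distr[OF entry_pair_measurable[OF p(1)] f, symmetric])
  also have "distr M borel (entry_pair A (i, j)) = distr M borel (entry_pair A (0, 1))"
    using iid_pairs p unfolding iid_vars_def by blast
  also have "integral\<^sup>L (distr M borel (entry_pair A (0, 1))) ?f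
      = expectation (\<lambda>\<omega>. ?f (entry_pair A (0, 1) \<omega>))"
    by (rule integral_distr[OF entry_pair_measurable[OF p(2)] f])
  also have "\<dots> = of_real t" using cov assms by (simp add: entry_pair_def)
  finally show ?thesis by (simp add: entry_pair_def)
qed

text \<open>One factor per pair and one per diagonal entry are independent, so the expectation
  multiplies over blocks, each involving at most one entry or the product of a transposed
  pair.\<close>

lemma
  fixes a c \<beta> :: complex
  assumes \<sigma>: "\<sigma> permutes {..<n}" and \<beta>: "\<beta>\<^sup>2 = c\<^sup>2 * of_real t"
  defines "B \<equiv> \<lambda>\<omega> i j. (if i = j then a else 0) - c * A \<omega> $$ (i, j)"
  shows expectation_prod_entries:
      "expectation (\<lambda>\<omega>. \<Prod>i<n. B \<omega> i (\<sigma> i)) = (\<Prod>i<n. involution_factor a \<beta> \<sigma> i)"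
    and integrable_prod_entries: "integrable M (\<lambda>\<omega>. \<Prod>i<n. B \<omega> i (\<sigma> i))"
proof -
  \<comment> \<open>\<open>\<phi>\<close> and \<open>g\<close> keep the entries that
    \<open>\<sigma>\<close> visits and are 1 elsewhere, which lets the products run over all pairs
    and all diagonal places, independently of \<open>\<sigma>\<close>.\<close>
  define \<phi> :: "nat \<times> nat \<Rightarrow> complex \<times> complex \<Rightarrow> complex" where
    "\<phi> = (\<lambda>(i, j) (x, y). (if \<sigma> i = j then - c * x else 1) * (if \<sigma> j = i then - c * y else 1))"
  define g :: "nat \<Rightarrow> complex \<Rightarrow> complex" where
    "g = (\<lambda>i x. if \<sigma> i = i then a - c * x else 1)"
  define P where "P = (\<lambda>\<omega>. \<Prod>p\<in>pair_indices n. \<phi> p (entry_pair A p \<omega>))"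
  define Q where "Q = (\<lambda>\<omega>. \<Prod>i<n. g i (diag_entry A i \<omega>))"
  have \<phi>_meas: "\<phi> p \<in> borel_measurable borel" for p
    unfolding \<phi>_def case_prod_unfold
    by (intro borel_measurable_continuous_onI) (cases "\<sigma> (fst p) = snd p"; cases "\<sigma> (snd p) = fst p"; auto intro!: continuous_intros)
  have g_meas: "g i \<in> borel_measurable borel" for i
    unfolding g_def by (cases "\<sigma> i = i") auto
  have split: "(\<lambda>\<omega>. \<Prod>i<n. B \<omega> i (\<sigma> i)) = (\<lambda>\<omega>. P \<omega> * Q \<omega>)"
  proof
    fix \<omega>
    have "P \<omega> = (\<Prod>(i, j)\<in>pair_indices n.
        (if \<sigma> i = j then B \<omega> i j else 1) * (if \<sigma> j = i then B \<omega> j i else 1))"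
      unfolding P_def
      by (intro prod.cong) (auto simp: \<phi>_def entry_pair_def B_def pair_indices_def)
    moreover have "Q \<omega> = (\<Prod>i<n. if \<sigma> i = i then B \<omega> i i else 1)"
      unfolding Q_def by (intro prod.cong) (auto simp: g_def diag_entry_def B_def)
    ultimately show "(\<Prod>i<n. B \<omega> i (\<sigma> i)) = P \<omega> * Q \<omega>"
      using prod_pair_indices[OF \<sigma>, of "B \<omega>"] by simp
  qed
  have indep_P: "indep_vars (\<lambda>_. borel) (\<lambda>p \<omega>. \<phi> p (entry_pair A p \<omega>)) (pair_indices n)"
    using iid_pairs unfolding iid_vars_def by (rule indep_vars_compose2[OF conjunct1 \<phi>_meas])
  have indep_Q: "indep_vars (\<lambda>_. borel) (\<lambda>i \<omega>. g i (diag_entry A i \<omega>)) {..<n}"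
    using iid_diag unfolding iid_vars_def by (rule indep_vars_compose2[OF conjunct1 g_meas])
  have indep_PQ: "indep_var borel P borel Q"
  proof (rule indep_families_imp_indep_var[OF indep_pairs_diag])
    show "P \<in> borel_measurable (sigma (space M)
        {entry_pair A p -` B \<inter> space M | p B. p \<in> pair_indices n \<and> B \<in> sets borel})"
      unfolding P_def
      by (intro borel_measurable_prod measurable_compose[OF measurable_sigma_family \<phi>_meas]) auto
    show "Q \<in> borel_measurable (sigma (space M)
        {diag_entry A i -` B \<inter> space M | i B. i \<in> {..<n} \<and> B \<in> sets borel})"
      unfolding Q_def
      by (intro borel_measurable_prod measurable_compose[OF measurable_sigma_family g_meas]) auto
  qed
  \<comment> \<open>Both directions used: the covariance enters. One direction: a centered entry is
    left. None: the constant 1.\<close>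
  have \<phi>_exp: "integrable M (\<lambda>\<omega>. \<phi> (i, j) (entry_pair A (i, j) \<omega>)) \<and>
      expectation (\<lambda>\<omega>. \<phi> (i, j) (entry_pair A (i, j) \<omega>)) =
        (if \<sigma> i = j \<and> \<sigma> j = i then \<beta>\<^sup>2 else if \<sigma> i = j \<or> \<sigma> j = i then 0 else 1)"
    if "(i, j) \<in> pair_indices n" for i j
  proof -
    have ij: "i < j" "j < n" "i < n" using that by (auto simp: pair_indices_def)
    have prod: "- c * A \<omega> $$ (i, j) * (- c * A \<omega> $$ (j, i)) = c\<^sup>2 * (A \<omega> $$ (i, j) * A \<omega> $$ (j, i))" for \<omega>
      by (simp add: power2_eq_square)
    consider "\<sigma> i = j" "\<sigma> j = i" | "\<sigma> i = j" "\<sigma> j \<noteq> i" | "\<sigma> i \<noteq> j" "\<sigma> j = i" | "\<sigma> i \<noteq> j" "\<sigma> j \<noteq> i"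
      by blast
    then show ?thesis
    proof cases
      case 1
      then show ?thesis
        using entry_mult_integrable[OF ij(3,2)] expectation_entry_mult[OF ij(1,2)] \<beta>
        by (simp only: \<phi>_def entry_pair_def prod.case fst_conv snd_conv if_True simp_thms prod
          integrable_mult_right integral_mult_right_zero)
    qed (use entry_integrable ij centered prob_space in \<open>simp_all add: \<phi>_def entry_pair_def\<close>)
  qed
  have g_exp: "integrable M (\<lambda>\<omega>. g i (diag_entry A i \<omega>)) \<and>
      expectation (\<lambda>\<omega>. g i (diag_entry A i \<omega>)) = (if \<sigma> i = i then a else 1)" if "i < n" for i
    using entry_integrable[OF that that] centered[OF that that] prob_space
    by (simp add: g_def diag_entry_def)
  have int_P: "integrable M P"
    unfolding P_def using \<phi>_exp
    by (intro indep_vars_integrable[OF finite_pair_indices indep_P]) auto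
  have int_Q: "integrable M Q"
    unfolding Q_def using g_exp
    by (intro indep_vars_integrable[OF finite_lessThan indep_Q]) auto
  have exp_P: "expectation P =
      (\<Prod>(i, j)\<in>pair_indices n. if \<sigma> i = j \<and> \<sigma> j = i then \<beta>\<^sup>2 else if \<sigma> i = j \<or> \<sigma> j = i then 0 else 1)"
    unfolding P_def using \<phi>_exp
    by (subst indep_vars_lebesgue_integral[OF finite_pair_indices indep_P]) (auto intro!: prod.cong)
  have exp_Q: "expectation Q = (\<Prod>i<n. if \<sigma> i = i then a else 1)"
    unfolding Q_def using g_exp
    by (subst indep_vars_lebesgue_integral[OF finite_lessThan indep_Q]) (auto intro!: prod.cong)
  show "integrable M (\<lambda>\<omega>. \<Prod>i<n. B \<omega> i (\<sigma> i))"
    unfolding split by (rule indep_var_integrable[OF indep_PQ int_P int_Q])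
  show "expectation (\<lambda>\<omega>. \<Prod>i<n. B \<omega> i (\<sigma> i)) = (\<Prod>i<n. involution_factor a \<beta> \<sigma> i)"
    unfolding split indep_var_lebesgue_integral[OF indep_PQ int_P int_Q] exp_P exp_Q
    by (rule prod_pair_indices_involution[OF \<sigma>])
qed

text \<open>Leibniz expansion and linearity of the expectation. A complex root
  \<open>\<beta>\<close> of \<open>c\<^sup>2 * t\<close> always exists, and only its square enters
  the result.\<close>

lemma expectation_det:
  fixes a c :: complex
  shows "expectation (\<lambda>\<omega>. Determinant.det (a \<cdot>\<^sub>m 1\<^sub>m n - c \<cdot>\<^sub>m A \<omega>)) = hermite a (c\<^sup>2 * of_real t) n"
proof -
  obtain \<beta> where \<beta>: "\<beta>\<^sup>2 = c\<^sup>2 * of_real t"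
    using power2_csqrt by blast
  define B where "B = (\<lambda>\<omega> i j. (if i = j then a else 0) - c * A \<omega> $$ (i, j))"
  have B_exp: "expectation (\<lambda>\<omega>. \<Prod>i<n. B \<omega> i (\<sigma> i)) = (\<Prod>i<n. involution_factor a \<beta> \<sigma> i)"
      "integrable M (\<lambda>\<omega>. \<Prod>i<n. B \<omega> i (\<sigma> i))" if "\<sigma> permutes {..<n}" for \<sigma>
    unfolding B_def using that by (rule expectation_prod_entries[OF _ \<beta>], rule integrable_prod_entries[OF _ \<beta>])
  have "expectation (\<lambda>\<omega>. Determinant.det (a \<cdot>\<^sub>m 1\<^sub>m n - c \<cdot>\<^sub>m A \<omega>)) =
      expectation (\<lambda>\<omega>. \<Sum>\<sigma> | \<sigma> permutes {..<n}. of_int (sign \<sigma>) * (\<Prod>i<n. B \<omega> i (\<sigma> i)))"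
  proof (rule Bochner_Integration.integral_cong[OF refl])
    fix \<omega> assume "\<omega> \<in> space M"
    then have A: "A \<omega> \<in> carrier_mat n n" by (rule dim)
    have "(a \<cdot>\<^sub>m 1\<^sub>m n - c \<cdot>\<^sub>m A \<omega>) \<in> carrier_mat n n" using A by auto
    then have "Determinant.det (a \<cdot>\<^sub>m 1\<^sub>m n - c \<cdot>\<^sub>m A \<omega>) =
        (\<Sum>\<sigma> | \<sigma> permutes {0..<n}. of_int (sign \<sigma>) *
          (\<Prod>i = 0..<n. (a \<cdot>\<^sub>m 1\<^sub>m n - c \<cdot>\<^sub>m A \<omega>) $$ (i, \<sigma> i)))"
      by (rule det_def')
    also have "\<dots> = (\<Sum>\<sigma> | \<sigma> permutes {..<n}. of_int (sign \<sigma>) * (\<Prod>i<n. B \<omega> i (\<sigma> i)))"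
      unfolding atLeast0LessThan
    proof (intro sum.cong[OF refl] arg_cong2[where f="(*)"] prod.cong refl)
      fix \<sigma> i assume "\<sigma> \<in> {\<sigma>. \<sigma> permutes {..<n}}" and i: "i \<in> {..<n}"
      then have "\<sigma> i < n" using permutes_in_image[of \<sigma> "{..<n}" i] by auto
      then show "(a \<cdot>\<^sub>m 1\<^sub>m n - c \<cdot>\<^sub>m A \<omega>) $$ (i, \<sigma> i) = B \<omega> i (\<sigma> i)"
        using A i by (auto simp: B_def)
    qed
    finally show "Determinant.det (a \<cdot>\<^sub>m 1\<^sub>m n - c \<cdot>\<^sub>m A \<omega>) =
        (\<Sum>\<sigma> | \<sigma> permutes {..<n}. of_int (sign \<sigma>) * (\<Prod>i<n. B \<omega> i (\<sigma> i)))" .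
  qed
  also have "\<dots> = (\<Sum>\<sigma> | \<sigma> permutes {..<n}. of_int (sign \<sigma>) * (\<Prod>i<n. involution_factor a \<beta> \<sigma> i))"
    using B_exp by (subst Bochner_Integration.integral_sum) (auto intro!: sum.cong)
  also have "\<dots> = hermite a (c\<^sup>2 * of_real t) n"
    using involution_sum_eq_hermite[of "{..<n}" a \<beta>] by (simp add: involution_sum_def \<beta>)
  finally show ?thesis .
qed

text \<open>Here \<open>c = z / sqrt n\<close>, so the variance is \<open>w / n\<close> with
  \<open>w = t * z\<^sup>2\<close>, the form treated above.\<close>

lemma expectation_normalized_char_poly:
  "expectation (\<lambda>\<omega>. normalized_char_poly n t z (A \<omega>)) =
     hermite (1 + of_real t * z\<^sup>2) (of_real t * z\<^sup>2 / of_nat n) n * exp (- (of_nat n * (of_real t * z\<^sup>2) / 2))"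
proof -
  have "(z / of_real (sqrt (real n)))\<^sup>2 * of_real t = of_real t * z\<^sup>2 / of_nat n"
    by (simp add: power_divide flip: of_real_power)
  then show ?thesis
    using expectation_det[of "1 + of_real t * z\<^sup>2" "z / of_real (sqrt (real n))"]
    by (simp add: normalized_char_poly_def mult.assoc)
qed

end

section \<open>The branch of the square root and uniformity in \<open>z\<close>\<close>

text \<open>The product of the principal power and \<open>s\<close> is continuous on the connected
  disc and has square 1; hence it is constant, and it equals 1 at the origin.\<close>

lemma inverse_sqrt_eq_powr:
  assumes t: "0 \<le> t" "t \<le> 1" and s_holo: "s holomorphic_on ball 0 1"
    and s_sq: "\<And>z. z \<in> ball 0 1 \<Longrightarrow> (s z)\<^sup>2 = 1 - of_real t * z\<^sup>2"
    and s_0: "s 0 = 1" and z: "z \<in> ball 0 1"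
  shows "(1 - of_real t * z\<^sup>2) powr (- 1 / 2) = 1 / s z"
proof -
  define f where "f z = (1 - of_real t * z\<^sup>2) powr (- 1 / 2 :: complex)" for z
  have less: "norm (of_real t * z\<^sup>2) < 1" if "z \<in> ball 0 1" for z :: complex
  proof -
    have "t * (norm z)\<^sup>2 \<le> 1 * (norm z)\<^sup>2" using t by (intro mult_right_mono) auto
    also have "\<dots> < 1" using that by (simp add: power_less_one_iff abs_square_less_1)
    finally show ?thesis using t by (simp add: norm_mult norm_power)
  qed
  \<comment> \<open>The argument stays in the open right half-plane, away from the branch cut of
    \<open>powr\<close>.\<close>
  have notneg: "1 - of_real t * z\<^sup>2 \<notin> \<real>\<^sub>\<le>\<^sub>0" if "z \<in> ball 0 1" for z :: complex
  proof -
    have "Re (of_real t * z\<^sup>2) < 1" using less[OF that] complex_Re_le_cmod by (rule le_less_trans[rotated])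
    then show ?thesis by (auto simp: complex_nonpos_Reals_iff)
  qed
  have f_sq: "(f z)\<^sup>2 * (1 - of_real t * z\<^sup>2) = 1" if "z \<in> ball 0 1" for z
  proof -
    have ne: "1 - of_real t * z\<^sup>2 \<noteq> 0" using notneg[OF that] by auto
    have "(f z)\<^sup>2 = (1 - of_real t * z\<^sup>2) powr (- 1)"
      by (simp add: f_def power2_eq_square flip: powr_add)
    then show ?thesis using ne by (simp add: powr_minus)
  qed
  have one: "(f z * s z)\<^sup>2 = 1" if "z \<in> ball 0 1" for z
    using f_sq[OF that] s_sq[OF that] by (simp add: power_mult_distrib)
  have "(\<lambda>z. f z * s z) constant_on ball 0 1"
  proof (rule continuous_finite_range_constant)
    show "continuous_on (ball 0 1) (\<lambda>z. f z * s z)"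
      unfolding f_def
      by (intro holomorphic_on_imp_continuous_on holomorphic_intros s_holo notneg)
    have "f z * s z \<in> {1, - 1}" if "z \<in> ball 0 1" for z
      using one[OF that] by (simp only: power2_eq_1_iff insert_iff empty_iff simp_thms)
    then have "(\<lambda>z. f z * s z) ` ball 0 1 \<subseteq> {1, - 1}" by blast
    then show "finite ((\<lambda>z. f z * s z) ` ball 0 1)" by (rule finite_subset) simp
  qed simp
  then obtain k where k: "\<And>z. z \<in> ball 0 1 \<Longrightarrow> f z * s z = k" by (auto simp: constant_on_def)
  have "k = 1" using k[of 0] s_0 by (simp add: f_def)
  with k[OF z] have fs: "f z * s z = 1" by simp
  then have "s z \<noteq> 0" by auto
  with fs show ?thesis by (simp add: f_def field_simps)
qed

text \<open>For \<open>t = 1\<close> the limit is unbounded near 1 and -1 while each expectation is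
  bounded on the disc, so uniformity can only be local; for \<open>t < 1\<close> it holds on the
  whole disc.\<close>

theorem theorem1p3:
  fixes M :: "nat \<Rightarrow> 'w measure" and A :: "nat \<Rightarrow> 'w \<Rightarrow> complex mat"
    and t :: real and s :: "complex \<Rightarrow> complex"
  assumes t: "0 \<le> t" "t \<le> 1"
    and A: "\<And>n. 1 \<le> n \<Longrightarrow> elliptic_matrix (M n) n t (A n)"
    and s_holo: "s holomorphic_on ball 0 1"
    and s_sq: "\<And>z. z \<in> ball 0 1 \<Longrightarrow> (s z)\<^sup>2 = 1 - of_real t * z\<^sup>2"
    and s_0: "s 0 = 1"
  shows "(\<forall>K. compact K \<and> K \<subseteq> ball 0 1 \<longrightarrow>
            uniform_limit K (\<lambda>n z. \<integral>\<omega>. normalized_char_poly n t z (A n \<omega>) \<partial>M n)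
              (\<lambda>z. 1 / s z) sequentially)
       \<and> (t < 1 \<longrightarrow>
            uniform_limit (ball 0 1) (\<lambda>n z. \<integral>\<omega>. normalized_char_poly n t z (A n \<omega>) \<partial>M n)
              (\<lambda>z. 1 / s z) sequentially)"
proof -
  \<comment> \<open>It suffices to keep \<open>t * z\<^sup>2\<close> in a fixed disc of radius
    \<open>r < 1\<close>. For compact \<open>K\<close>, \<open>r\<close> is the squared maximal
    modulus on \<open>K\<close>; for \<open>t < 1\<close>, \<open>r = t\<close>.\<close>
  have main: "uniform_limit K (\<lambda>n z. \<integral>\<omega>. normalized_char_poly n t z (A n \<omega>) \<partial>M n)
      (\<lambda>z. 1 / s z) sequentially"
    if K: "K \<subseteq> ball 0 1" and r: "r < 1" "\<And>z. z \<in> K \<Longrightarrow> norm (of_real t * z\<^sup>2) \<le> r" for K r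
  proof -
    let ?H = "\<lambda>n w. hermite (1 + w) (w / of_nat n) n * exp (- (of_nat n * w / 2))"
    have "uniform_limit K (\<lambda>n z. ?H n (of_real t * z\<^sup>2))
        (\<lambda>z. (1 - of_real t * z\<^sup>2) powr (- 1 / 2)) sequentially"
      by (rule uniform_limit_compose'[OF hermite_uniform_limit[OF r(1)]]) (use r(2) in auto)
    also have "?this \<longleftrightarrow> ?thesis"
    proof (rule uniform_limit_cong)
      show "eventually (\<lambda>n. \<forall>z\<in>K. ?H n (of_real t * z\<^sup>2) = (\<integral>\<omega>. normalized_char_poly n t z (A n \<omega>) \<partial>M n)) sequentially"
        using eventually_ge_at_top[of 1]
        by eventually_elim (simp add: elliptic_matrix.expectation_normalized_char_poly[OF A])
      show "(1 - of_real t * z\<^sup>2) powr (- 1 / 2) = 1 / s z" if "z \<in> K" for z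
        using inverse_sqrt_eq_powr[OF t s_holo s_sq s_0] that K by blast
    qed
    finally show ?thesis .
  qed
  have le_t: "norm (of_real t * z\<^sup>2) \<le> t" if "z \<in> ball 0 1" for z :: complex
  proof -
    have "t * (norm z)\<^sup>2 \<le> t * 1" using that t by (intro mult_left_mono) (auto simp: abs_square_le_1)
    then show ?thesis using t by (simp add: norm_mult norm_power)
  qed
  show ?thesis
  proof (intro conjI allI impI)
    fix K :: "complex set" assume K: "compact K \<and> K \<subseteq> ball 0 1"
    show "uniform_limit K (\<lambda>n z. \<integral>\<omega>. normalized_char_poly n t z (A n \<omega>) \<partial>M n) (\<lambda>z. 1 / s z) sequentially"
    proof (cases "K = {}")
      case False
      have "continuous_on K norm" by (intro continuous_intros)
      with K False obtain x where x: "x \<in> K" "\<And>z. z \<in> K \<Longrightarrow> norm z \<le> norm x"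
        using continuous_attains_sup[of K norm] by blast
      show ?thesis
      proof (rule main)
        show "K \<subseteq> ball 0 1" using K by blast
        show "(norm x)\<^sup>2 < 1" using x K by (auto simp: abs_square_less_1)
        fix z assume "z \<in> K"
        then have "t * (norm z)\<^sup>2 \<le> 1 * (norm x)\<^sup>2"
          using t x by (intro mult_mono power_mono) auto
        then show "norm (of_real t * z\<^sup>2) \<le> (norm x)\<^sup>2"
          using t by (simp add: norm_mult norm_power)
      qed
    qed simp
  next
    assume "t < 1"
    then show "uniform_limit (ball 0 1) (\<lambda>n z. \<integral>\<omega>. normalized_char_poly n t z (A n \<omega>) \<partial>M n) (\<lambda>z. 1 / s z) sequentially"
      using le_t by (intro main) auto
  qed
qed

end
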